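(* Let $\gamma>0$ and let $k_2,k_3$ be positive integers. For $\varepsilon>0$ let $\mathbf w=(\varsigma,\mathbf q,w,\mathbf p,\varphi)$ (depending on $\varepsilon$) be a smooth solution on $\Omega$ (with periodic boundary conditions) and $t\ge 0$ of the system $$\varsigma_t+\nabla\cdot\Big(\frac{\mathbf q}{\kappa_3}\Big)=0,\qquad \mathbf q_t+\nabla\Big(g'(\varsigma)+\frac{\varsigma-\varphi}{\kappa_1}\Big)=-\frac{\mathbf q}{\kappa_3},\qquad w_t-\nabla\cdot(\gamma\mathbf p)=\frac{\varsigma-\varphi}{\kappa_1},$$ $$\mathbf p_t-\frac{\nabla w}{\kappa_2}=0,\qquad \varphi_t=\frac{w}{\kappa_2},$$ with parameters $\kappa_1=\varepsilon$, $\kappa_2=\gamma\varepsilon^{k_2}$, $\kappa_3=\varepsilon^{k_3}$ and $g(c)=\frac14(c^2-1)^2$. Assume that $\mathbf w$ possesses a Hilbert expansion $$\mathbf w(\mathbf x,t)=\mathbf w_0(\mathbf x,t)+\varepsilon\,\mathbf w_1(\mathbf x,t)+\varepsilon^2\,\mathbf w_2(\mathbf x,t)+\cdots .$$ Assume that the initial condition is well-prepared, i.e. $$\varsigma(\mathbf x,t=0)=c(\mathbf x,t=0)+\mathcal O(\varepsilon),\qquad \mathbf p(\mathbf x,t=0)=\nabla\varphi(\mathbf x,t=0)+\mathcal O(\varepsilon),$$ where $c(\cdot,0)$ is the ($\varepsilon$-independent) initial datum for the Cahn-Hilliard equation. Then $\varsigma_0$, the first component of $\mathbf w_0$, satisfies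 the Cahn-Hilliard equation $$\partial_t \varsigma_0=\Delta\big(g'(\varsigma_0)-\gamma\Delta\varsigma_0\big).$$
   Context: $\Omega\subset\mathbb R^d$ is a spatial domain with periodic boundary conditions. $\varsigma,w,\varphi$ are scalar-valued, $\mathbf q,\mathbf p$ are $\mathbb R^d$-valued functions of $(\mathbf x,t)$. Hilbert expansion: the coefficient functions $\mathbf w_j=(\varsigma_j,\mathbf q_j,w_j,\mathbf p_j,\varphi_j)$, $j\ge 0$, are smooth (periodic in space) and independent of $\varepsilon$; the expansion is a formal (asymptotic) power series in $\varepsilon$ that may be differentiated term by term in space and time and inserted in the equations, so that the equations hold order by order, i.e. the coefficients of each power of $\varepsilon$ on both sides agree. Likewise the initial conditions hold order by order in $\varepsilon$. *)

theory Defs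
  imports "HOL-Analysis.Analysis" "HOL-Library.Landau_Symbols"
begin

section \<open>Differential operators\<close>

definition partial :: "'d::finite \<Rightarrow> (real^'d \<Rightarrow> 'a::real_normed_vector) \<Rightarrow> real^'d \<Rightarrow> 'a" where
  "partial i f x = vector_derivative (\<lambda>s. f (x + s *\<^sub>R axis i 1)) (at 0)"

definition grad :: "(real^'d \<Rightarrow> real) \<Rightarrow> real^'d \<Rightarrow> real^'d::finite" where
  "grad f x = (\<chi> i. partial i f x)"

definition divergence :: "(real^'d::finite \<Rightarrow> real^'d) \<Rightarrow> real^'d \<Rightarrow> real" where
  "divergence v x = (\<Sum>i\<in>UNIV. partial i (\<lambda>y. v y $ i) x)"

definition laplacian :: "(real^'d::finite \<Rightarrow> real) \<Rightarrow> real^'d \<Rightarrow> real" where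
  "laplacian f = divergence (grad f)"

text \<open>Fields are functions of space and time that matter only for times \<open>t \<ge> 0\<close>;
  at \<open>t = 0\<close> the time derivative is one-sided.\<close>

definition dt :: "(real^'d::finite \<Rightarrow> real \<Rightarrow> 'a::real_normed_vector) \<Rightarrow> real^'d \<Rightarrow> real \<Rightarrow> 'a" where
  "dt u x t = vector_derivative (\<lambda>s. u x s) (at t within {0..})"


section \<open>Smooth periodic fields\<close>

text \<open>\<open>Ck_field k u\<close>: all partial derivatives of \<open>u\<close> in space and time up to order \<open>k\<close>
  exist and are continuous on space times \<open>[0, \<infinity>)\<close>.\<close>

primrec Ck_field :: "nat \<Rightarrow> (real^'d::finite \<Rightarrow> real \<Rightarrow> 'a::real_normed_vector) \<Rightarrow> bool" where
  "Ck_field 0 u \<longleftrightarrow> continuous_on (UNIV \<times> {0..}) (\<lambda>(x, t). u x t)"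
| "Ck_field (Suc k) u \<longleftrightarrow>
     continuous_on (UNIV \<times> {0..}) (\<lambda>(x, t). u x t) \<and>
     (\<forall>x. \<forall>t\<ge>0. (\<forall>i. (\<lambda>s. u (x + s *\<^sub>R axis i 1) t) differentiable (at 0)) \<and>
                 (\<lambda>s. u x s) differentiable (at t within {0..})) \<and>
     (\<forall>i. Ck_field k (\<lambda>x t. partial i (\<lambda>y. u y t) x)) \<and>
     Ck_field k (dt u)"

definition smooth_field :: "(real^'d::finite \<Rightarrow> real \<Rightarrow> 'a::real_normed_vector) \<Rightarrow> bool" where
  "smooth_field u \<longleftrightarrow> (\<forall>k. Ck_field k u)"

text \<open>The spatial domain is the box with side lengths \<open>L $ i\<close> and opposite faces identified;
  functions on it are represented by their periodic extensions.\<close>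

definition periodic_field :: "real^'d::finite \<Rightarrow> (real^'d \<Rightarrow> real \<Rightarrow> 'a) \<Rightarrow> bool" where
  "periodic_field L u \<longleftrightarrow> (\<forall>x. \<forall>t\<ge>0. \<forall>i. u (x + (L $ i) *\<^sub>R axis i 1) t = u x t)"


section \<open>The relaxation system and the Cahn--Hilliard equation\<close>

text \<open>The tuple of unknowns (varsigma, q, w, p, varphi).\<close>

datatype 'd state = State
  (vs: "real^'d::finite \<Rightarrow> real \<Rightarrow> real")
  (qf: "real^'d::finite \<Rightarrow> real \<Rightarrow> real^'d")
  (wf: "real^'d::finite \<Rightarrow> real \<Rightarrow> real")
  (pf: "real^'d::finite \<Rightarrow> real \<Rightarrow> real^'d")
  (vp: "real^'d::finite \<Rightarrow> real \<Rightarrow> real")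

definition smooth_periodic_state :: "real^'d::finite \<Rightarrow> 'd state \<Rightarrow> bool" where
  "smooth_periodic_state L W \<longleftrightarrow>
     smooth_field (vs W) \<and> periodic_field L (vs W) \<and>
     smooth_field (qf W) \<and> periodic_field L (qf W) \<and>
     smooth_field (wf W) \<and> periodic_field L (wf W) \<and>
     smooth_field (pf W) \<and> periodic_field L (pf W) \<and>
     smooth_field (vp W) \<and> periodic_field L (vp W)"

definition g :: "real \<Rightarrow> real" where
  "g c = 1/4 * (c^2 - 1)^2"

definition relaxation_system ::
    "real \<Rightarrow> real \<Rightarrow> real \<Rightarrow> real \<Rightarrow> 'd::finite state \<Rightarrow> bool" where
  "relaxation_system \<gamma> \<kappa>1 \<kappa>2 \<kappa>3 W \<longleftrightarrow> (\<forall>x. \<forall>t\<ge>0.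
     dt (vs W) x t + divergence (\<lambda>y. qf W y t /\<^sub>R \<kappa>3) x = 0 \<and>
     dt (qf W) x t + grad (\<lambda>y. deriv g (vs W y t) + (vs W y t - vp W y t) / \<kappa>1) x
       = - (qf W x t /\<^sub>R \<kappa>3) \<and>
     dt (wf W) x t - divergence (\<lambda>y. \<gamma> *\<^sub>R pf W y t) x = (vs W x t - vp W x t) / \<kappa>1 \<and>
     dt (pf W) x t - grad (\<lambda>y. wf W y t) x /\<^sub>R \<kappa>2 = 0 \<and>
     dt (vp W) x t = wf W x t / \<kappa>2)"

definition cahn_hilliard :: "real \<Rightarrow> (real^'d::finite \<Rightarrow> real \<Rightarrow> real) \<Rightarrow> bool" where
  "cahn_hilliard \<gamma> c \<longleftrightarrow> (\<forall>x. \<forall>t\<ge>0.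
     dt c x t = laplacian (\<lambda>y. deriv g (c y t) - \<gamma> * laplacian (\<lambda>z. c z t) y) x)"


section \<open>Hilbert expansions\<close>

text \<open>\<open>f \<epsilon> ~ a 0 + \<epsilon> a 1 + \<epsilon>^2 a 2 + ...\<close> as \<open>\<epsilon>\<close> decreases to 0, without any
  convergence of the series.\<close>

definition asymp_series :: "(real \<Rightarrow> 'a::real_normed_vector) \<Rightarrow> (nat \<Rightarrow> 'a) \<Rightarrow> bool" where
  "asymp_series f a \<longleftrightarrow>
     (\<forall>N. (\<lambda>\<epsilon>. norm (f \<epsilon> - (\<Sum>j<N. \<epsilon>^j *\<^sub>R a j))) \<in> O[at_right 0](\<lambda>\<epsilon>. \<epsilon>^N))"

text \<open>An asymptotic series that may be differentiated term by term. Only the first-order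
  derivatives, which are the ones that occur in the system, are required to be expandable, and
  the remainders need not be uniform in space or time. Order-by-order validity of the
  equations is not required separately: it follows by inserting the series.\<close>

definition termwise_expansion ::
    "(real \<Rightarrow> real^'d::finite \<Rightarrow> real \<Rightarrow> 'a::real_normed_vector) \<Rightarrow>
     (nat \<Rightarrow> real^'d \<Rightarrow> real \<Rightarrow> 'a) \<Rightarrow> bool" where
  "termwise_expansion u a \<longleftrightarrow> (\<forall>x. \<forall>t\<ge>0.
     asymp_series (\<lambda>\<epsilon>. u \<epsilon> x t) (\<lambda>j. a j x t) \<and>
     asymp_series (\<lambda>\<epsilon>. dt (u \<epsilon>) x t) (\<lambda>j. dt (a j) x t) \<and>
     (\<forall>i. asymp_series (\<lambda>\<epsilon>. partial i (\<lambda>y. u \<epsilon> y t) x) (\<lambda>j. partial i (\<lambda>y. a j y t) x)))"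

definition hilbert_expansion ::
    "real^'d::finite \<Rightarrow> (real \<Rightarrow> 'd state) \<Rightarrow> (nat \<Rightarrow> 'd state) \<Rightarrow> bool" where
  "hilbert_expansion L W Wc \<longleftrightarrow>
     (\<forall>j. smooth_periodic_state L (Wc j)) \<and>
     termwise_expansion (\<lambda>\<epsilon>. vs (W \<epsilon>)) (\<lambda>j. vs (Wc j)) \<and>
     termwise_expansion (\<lambda>\<epsilon>. qf (W \<epsilon>)) (\<lambda>j. qf (Wc j)) \<and>
     termwise_expansion (\<lambda>\<epsilon>. wf (W \<epsilon>)) (\<lambda>j. wf (Wc j)) \<and>
     termwise_expansion (\<lambda>\<epsilon>. pf (W \<epsilon>)) (\<lambda>j. pf (Wc j)) \<and>
     termwise_expansion (\<lambda>\<epsilon>. vp (W \<epsilon>)) (\<lambda>j. vp (Wc j))"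

definition well_prepared :: "(real^'d::finite \<Rightarrow> real) \<Rightarrow> (real \<Rightarrow> 'd state) \<Rightarrow> bool" where
  "well_prepared c_init W \<longleftrightarrow> (\<forall>x.
     (\<lambda>\<epsilon>. vs (W \<epsilon>) x 0 - c_init x) \<in> O[at_right 0](\<lambda>\<epsilon>. \<epsilon>) \<and>
     (\<lambda>\<epsilon>. norm (pf (W \<epsilon>) x 0 - grad (\<lambda>y. vp (W \<epsilon>) y 0) x)) \<in> O[at_right 0](\<lambda>\<epsilon>. \<epsilon>))"

end

theory Submission
  imports Defs
begin

text \<open>Inserting the expansions, the \<open>\<phi>\<close>-equation makes \<open>w\<close> start at order \<open>k2\<close> with
  \<open>w\<^sub>k\<^sub>2 = \<gamma> \<partial>\<^sub>t \<phi>\<^sub>0\<close>, so the \<open>p\<close>-equation gives \<open>\<partial>\<^sub>t (p\<^sub>0 - \<nabla>\<phi>\<^sub>0) = 0\<close> and well-preparedness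
  propagates: \<open>p\<^sub>0 = \<nabla>\<phi>\<^sub>0\<close> for all times. The \<open>w\<close>-equation gives \<open>\<varsigma>\<^sub>0 = \<phi>\<^sub>0\<close> and
  \<open>\<varsigma>\<^sub>1 - \<phi>\<^sub>1 = -\<gamma> \<Delta>\<varsigma>\<^sub>0\<close>. Hence the gradient in the \<open>q\<close>-equation stays bounded, \<open>q\<close> starts at
  order \<open>k3\<close> with \<open>q\<^sub>k\<^sub>3 = -\<nabla>(g'(\<varsigma>\<^sub>0) + \<varsigma>\<^sub>1 - \<phi>\<^sub>1)\<close>, and the \<open>\<varsigma>\<close>-equation closes the loop.\<close>

section \<open>Asymptotic series\<close>

text \<open>The truncation with \<open>Suc N\<close> terms reduces to its last one, and the
  remainder of order \<open>N + 1\<close> still vanishes after division by the \<open>N\<close>-th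
  power of \<epsilon>.\<close>

lemma asymp_series_leading:
  assumes f: "asymp_series f a" and z: "\<And>j. j < N \<Longrightarrow> a j = 0"
  shows "((\<lambda>\<epsilon>. f \<epsilon> /\<^sub>R \<epsilon>^N) \<longlongrightarrow> a N) (at_right 0)"
proof -
  have "(\<lambda>\<epsilon>. norm (f \<epsilon> - (\<Sum>j<Suc N. \<epsilon>^j *\<^sub>R a j))) \<in> O[at_right 0](\<lambda>\<epsilon>. \<epsilon>^Suc N)"
    using f unfolding asymp_series_def by blast
  moreover have "(\<Sum>j<Suc N. \<epsilon>^j *\<^sub>R a j) = \<epsilon>^N *\<^sub>R a N" for \<epsilon> :: real
    using z by simp
  ultimately obtain C where
    C: "eventually (\<lambda>\<epsilon>. norm (f \<epsilon> - \<epsilon>^N *\<^sub>R a N) \<le> C * \<bar>\<epsilon>^Suc N\<bar>) (at_right 0)"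
    by (auto elim!: landau_o.bigE)
  have "eventually (\<lambda>\<epsilon>. norm (f \<epsilon> /\<^sub>R \<epsilon>^N - a N) \<le> norm \<epsilon> * C) (at_right 0)"
    using C eventually_at_right_less[of "0::real"]
  proof eventually_elim
    case (elim \<epsilon>)
    have "f \<epsilon> /\<^sub>R \<epsilon>^N - a N = (f \<epsilon> - \<epsilon>^N *\<^sub>R a N) /\<^sub>R \<epsilon>^N"
      using elim(2) by (simp add: scaleR_diff_right)
    then have "norm (f \<epsilon> /\<^sub>R \<epsilon>^N - a N) = norm (f \<epsilon> - \<epsilon>^N *\<^sub>R a N) / \<epsilon>^N"
      using elim(2) by (simp add: divide_inverse_commute)
    also have "\<dots> \<le> C * \<bar>\<epsilon>^Suc N\<bar> / \<epsilon>^N"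
      using elim by (intro divide_right_mono) auto
    also have "\<dots> = norm \<epsilon> * C"
      using elim(2) by (simp add: abs_mult)
    finally show ?case .
  qed
  then have "((\<lambda>\<epsilon>. f \<epsilon> /\<^sub>R \<epsilon>^N - a N) \<longlongrightarrow> 0) (at_right 0)"
    by (rule tendsto_0_le[rotated]) (rule tendsto_ident_at)
  then show ?thesis
    by (simp add: LIM_zero_iff)
qed

lemma asymp_series_tendsto:
  assumes "asymp_series f a"
  shows "(f \<longlongrightarrow> a 0) (at_right 0)"
  using asymp_series_leading[OF assms, of 0] by simp

text \<open>The tool for matching orders. An equation of the system supplies the factor
  \<open>h\<close>, which only has to converge. Once the coefficients below \<open>j\<close> vanish,
  the quotient of \<open>f\<close> by the \<open>j\<close>-th power of \<epsilon> has two limits,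
  which must agree.\<close>

lemma asymp_series_unique:
  assumes f: "asymp_series f a"
    and fh: "\<And>\<epsilon>. \<epsilon> > 0 \<Longrightarrow> f \<epsilon> = \<epsilon>^N *\<^sub>R h \<epsilon>" and h: "(h \<longlongrightarrow> l) (at_right 0)"
  shows "a N = l" and "j < N \<Longrightarrow> a j = 0"
proof -
  \<comment> \<open>The factor \<open>0 ^ (N - j)\<close> covers both cases: it is 0 for
    \<open>j < N\<close> and 1 for \<open>j = N\<close>.\<close>
  have scaled: "((\<lambda>\<epsilon>. f \<epsilon> /\<^sub>R \<epsilon>^j) \<longlongrightarrow> 0 ^ (N - j) *\<^sub>R l) (at_right 0)" if "j \<le> N" for j
  proof -
    have "((\<lambda>\<epsilon>::real. \<epsilon>^(N - j) *\<^sub>R h \<epsilon>) \<longlongrightarrow> 0 ^ (N - j) *\<^sub>R l) (at_right 0)"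
      by (intro tendsto_intros h)
    moreover have "eventually (\<lambda>\<epsilon>::real. \<epsilon>^(N - j) *\<^sub>R h \<epsilon> = f \<epsilon> /\<^sub>R \<epsilon>^j) (at_right 0)"
      using eventually_at_right_less[of "0::real"]
      by eventually_elim (use that in \<open>simp add: fh power_diff divide_inverse_commute\<close>)
    ultimately show ?thesis
      by (rule Lim_transform_eventually)
  qed
  have low: "a j = 0" if "j < N" for j
    using that
  proof (induction j rule: less_induct)
    case (less j)
    then have "((\<lambda>\<epsilon>. f \<epsilon> /\<^sub>R \<epsilon>^j) \<longlongrightarrow> a j) (at_right 0)"
      by (intro asymp_series_leading[OF f]) auto
    from tendsto_unique[OF _ this scaled] less.prems show ?case
      by simp
  qed
  then show "j < N \<Longrightarrow> a j = 0" .
  show "a N = l"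
    using tendsto_unique[OF _ asymp_series_leading[OF f low] scaled[of N]] by simp
qed

lemma bigo_dominated:
  fixes f h k :: "'a \<Rightarrow> real"
  assumes "h \<in> O[F](k)" "\<And>x. norm (f x) \<le> norm (h x)"
  shows "f \<in> O[F](k)"
  using landau_o.big_mono[of f h F] assms by (blast intro: landau_o.big_trans always_eventually)

text \<open>Serves \<open>vs - vp\<close> and its space derivatives, whose leading coefficients will
  cancel against the factor 1/\<epsilon>.\<close>

lemma asymp_series_diff:
  assumes "asymp_series f a" "asymp_series h b"
  shows "asymp_series (\<lambda>\<epsilon>. f \<epsilon> - h \<epsilon>) (\<lambda>j. a j - b j)"
  unfolding asymp_series_def
proof
  fix N
  let ?F = "\<lambda>\<epsilon>. norm (f \<epsilon> - (\<Sum>j<N. \<epsilon>^j *\<^sub>R a j))"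
  let ?H = "\<lambda>\<epsilon>. norm (h \<epsilon> - (\<Sum>j<N. \<epsilon>^j *\<^sub>R b j))"
  have "(\<lambda>\<epsilon>. ?F \<epsilon> + ?H \<epsilon>) \<in> O[at_right 0](\<lambda>\<epsilon>. \<epsilon>^N)"
    by (rule sum_in_bigo) (use assms in \<open>auto simp: asymp_series_def\<close>)
  then show "(\<lambda>\<epsilon>. norm (f \<epsilon> - h \<epsilon> - (\<Sum>j<N. \<epsilon>^j *\<^sub>R (a j - b j))))
      \<in> O[at_right 0](\<lambda>\<epsilon>. \<epsilon>^N)"
  proof (rule bigo_dominated)
    fix \<epsilon> :: real
    have "f \<epsilon> - h \<epsilon> - (\<Sum>j<N. \<epsilon>^j *\<^sub>R (a j - b j))
        = (f \<epsilon> - (\<Sum>j<N. \<epsilon>^j *\<^sub>R a j)) - (h \<epsilon> - (\<Sum>j<N. \<epsilon>^j *\<^sub>R b j))"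
      by (simp add: scaleR_diff_right sum_subtractf)
    then have "norm (f \<epsilon> - h \<epsilon> - (\<Sum>j<N. \<epsilon>^j *\<^sub>R (a j - b j))) \<le> ?F \<epsilon> + ?H \<epsilon>"
      by (simp only: norm_triangle_ineq4)
    then show "norm (norm (f \<epsilon> - h \<epsilon> - (\<Sum>j<N. \<epsilon>^j *\<^sub>R (a j - b j)))) \<le> norm (?F \<epsilon> + ?H \<epsilon>)"
      by simp
  qed
qed

lemma asymp_series_nth:
  fixes f :: "real \<Rightarrow> real^'n::finite"
  assumes "asymp_series f a"
  shows "asymp_series (\<lambda>\<epsilon>. f \<epsilon> $ i) (\<lambda>j. a j $ i)"
  unfolding asymp_series_def
proof
  fix N
  have "(\<lambda>\<epsilon>. norm (f \<epsilon> - (\<Sum>j<N. \<epsilon>^j *\<^sub>R a j))) \<in> O[at_right 0](\<lambda>\<epsilon>. \<epsilon>^N)"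
    using assms unfolding asymp_series_def by blast
  then show "(\<lambda>\<epsilon>. norm (f \<epsilon> $ i - (\<Sum>j<N. \<epsilon>^j *\<^sub>R a j $ i))) \<in> O[at_right 0](\<lambda>\<epsilon>. \<epsilon>^N)"
  proof (rule bigo_dominated)
    show "norm (norm (f \<epsilon> $ i - (\<Sum>j<N. \<epsilon>^j *\<^sub>R a j $ i)))
        \<le> norm (norm (f \<epsilon> - (\<Sum>j<N. \<epsilon>^j *\<^sub>R a j)))" for \<epsilon>
      using component_le_norm_cart[of "f \<epsilon> - (\<Sum>j<N. \<epsilon>^j *\<^sub>R a j)" i] by simp
  qed
qed

section \<open>Derivatives of smooth fields\<close>

lemma partialI:
  "((\<lambda>s. f (x + s *\<^sub>R axis i 1)) has_vector_derivative D) (at 0) \<Longrightarrow> partial i f x = D"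
  unfolding partial_def by (rule vector_derivative_at)

lemma smooth_field_partial:
  assumes "smooth_field u" "t \<ge> 0"
  shows "((\<lambda>s. u (x + s *\<^sub>R axis i 1) t) has_vector_derivative partial i (\<lambda>y. u y t) x) (at 0)"
proof -
  have "Ck_field (Suc 0) u"
    using assms(1) unfolding smooth_field_def by blast
  then show ?thesis
    using assms(2) by (simp add: partial_def flip: vector_derivative_works)
qed

text \<open>Differentiability is recorded only at parameter 0 of each line. A shift of the base
  point moves it to any \<open>s\<close>, as differentiation under the integral sign
  demands.\<close>

lemma smooth_field_partial_line:
  assumes "smooth_field u" "t \<ge> 0"
  shows "((\<lambda>s. u (x + s *\<^sub>R axis i 1) t) has_vector_derivative
    partial i (\<lambda>y. u y t) (x + s *\<^sub>R axis i 1)) (at s within S)"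
proof -
  have d: "((\<lambda>r. r - s) has_vector_derivative 1) (at s)"
    by (auto intro!: derivative_eq_intros)
  \<comment> \<open>The base point is written \<open>s - s\<close> because the chain rule expects
    the image of \<open>s\<close> under the shift.\<close>
  have "((\<lambda>r. u (x + s *\<^sub>R axis i 1 + r *\<^sub>R axis i 1) t) has_vector_derivative
      partial i (\<lambda>y. u y t) (x + s *\<^sub>R axis i 1)) (at (s - s))"
    using smooth_field_partial[OF assms] by simp
  from vector_diff_chain_at[OF d this]
  show ?thesis
    by (auto simp: o_def algebra_simps intro: has_vector_derivative_at_within)
qed

lemma smooth_field_dt:
  assumes "smooth_field u" "t \<ge> 0"
  shows "((\<lambda>s. u x s) has_vector_derivative dt u x t) (at t within {0..})"
proof -
  have "Ck_field (Suc 0) u"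
    using assms(1) unfolding smooth_field_def by blast
  then show ?thesis
    using assms(2) by (simp add: dt_def flip: vector_derivative_works)
qed

lemma smooth_field_dt_smooth: "smooth_field u \<Longrightarrow> smooth_field (dt u)"
  unfolding smooth_field_def using Ck_field.simps(2)[of _ u] by blast

lemma smooth_field_partial_smooth:
  "smooth_field u \<Longrightarrow> smooth_field (\<lambda>x t. partial i (\<lambda>y. u y t) x)"
  unfolding smooth_field_def using Ck_field.simps(2)[of _ u] by blast

lemma smooth_field_continuous:
  "smooth_field u \<Longrightarrow> continuous_on (UNIV \<times> {0..}) (\<lambda>(x, t). u x t)"
  unfolding smooth_field_def using Ck_field.simps(1)[of u] by blast

lemma dt_zero:
  assumes "\<And>s. s \<ge> 0 \<Longrightarrow> u x s = 0" "t \<ge> 0"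
  shows "dt u x t = 0"
proof -
  have "((\<lambda>s. u x s) has_vector_derivative 0) (at t within {0..})"
    using assms by (intro has_vector_derivative_transform[OF _ _ has_vector_derivative_const]) auto
  \<comment> \<open>The one-sided derivative is unique only because \<open>t\<close> is a limit
    point of the half-line, also for \<open>t = 0\<close>.\<close>
  moreover have "at t within {0..} \<noteq> bot"
    using assms(2) islimpt_subset[of t "{0..t + 1}" "{0..}"] by (simp add: trivial_limit_within)
  ultimately show ?thesis
    unfolding dt_def by (intro vector_derivative_within)
qed

lemma partial_zero: "(\<And>y. f y = 0) \<Longrightarrow> partial i f x = 0"
  by (intro partialI) (simp add: has_vector_derivative_const)

lemma partial_nth:
  assumes "smooth_field u" "t \<ge> 0"
  shows "partial i (\<lambda>y. u y t $ j) x = partial i (\<lambda>y. u y t) x $ j"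
  using bounded_linear.has_vector_derivative[OF bounded_linear_vec_nth smooth_field_partial[OF assms]]
  by (rule partialI)

lemma partial_cmult:
  fixes u :: "real^'d::finite \<Rightarrow> real \<Rightarrow> real"
  assumes "smooth_field u" "t \<ge> 0"
  shows "partial i (\<lambda>y. c * u y t) x = c * partial i (\<lambda>y. u y t) x"
  using has_vector_derivative_mult_right[OF smooth_field_partial[OF assms]] by (rule partialI)

lemma divergence_scaleR:
  assumes "smooth_field u" "t \<ge> 0"
  shows "divergence (\<lambda>y. c *\<^sub>R u y t) x = c * divergence (\<lambda>y. u y t) x"
proof -
  have "((\<lambda>s. c * u (x + s *\<^sub>R axis i 1) t $ i) has_vector_derivative
      c * partial i (\<lambda>y. u y t) x $ i) (at 0)" for i
    by (intro has_vector_derivative_mult_right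
        bounded_linear.has_vector_derivative[OF bounded_linear_vec_nth smooth_field_partial[OF assms]])
  then have "partial i (\<lambda>y. c * u y t $ i) x = c * partial i (\<lambda>y. u y t) x $ i" for i
    by (rule partialI)
  then show ?thesis
    unfolding divergence_def by (simp add: sum_distrib_left partial_nth[OF assms])
qed

lemma dt_has_integral:
  fixes u :: "real^'d::finite \<Rightarrow> real \<Rightarrow> 'a::banach"
  assumes "smooth_field u" "t \<ge> 0"
  shows "(dt u x has_integral (u x t - u x 0)) {0..t}"
  using assms(2)
  by (intro fundamental_theorem_of_calculus)
     (auto intro: has_vector_derivative_within_subset[OF smooth_field_dt[OF assms(1)]])

text \<open>Differentiating the fundamental theorem of calculus under the integral sign replaces
  the symmetry of mixed derivatives, which is awkward at the boundary time \<open>t = 0\<close>.\<close>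

lemma partial_dt_integral:
  fixes u :: "real^'d::finite \<Rightarrow> real \<Rightarrow> real"
  assumes u: "smooth_field u" and t: "t \<ge> 0"
  shows "integral {0..t} (\<lambda>\<tau>. partial i (\<lambda>y. dt u y \<tau>) x)
    = partial i (\<lambda>y. u y t) x - partial i (\<lambda>y. u y 0) x"
proof -
  let ?x = "\<lambda>s. x + s *\<^sub>R axis i 1"
  note du = smooth_field_dt_smooth[OF u]
  have "((\<lambda>s. integral (cbox 0 t) (dt u (?x s))) has_vector_derivative
      integral (cbox 0 t) (\<lambda>\<tau>. partial i (\<lambda>y. dt u y \<tau>) (?x 0))) (at 0 within UNIV)"
  proof (rule leibniz_rule_vector_derivative)
    show "((\<lambda>s. dt u (?x s) \<tau>) has_vector_derivative partial i (\<lambda>y. dt u y \<tau>) (?x s)) (at s within UNIV)"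
      if "\<tau> \<in> cbox 0 t" for s \<tau>
      using that by (intro smooth_field_partial_line du) auto
    show "dt u (?x s) integrable_on cbox 0 t" for s
      using dt_has_integral[OF u t] by (auto simp: integrable_on_def)
    have "continuous_on (UNIV \<times> cbox 0 t) ((\<lambda>(y, \<tau>). partial i (\<lambda>y. dt u y \<tau>) y) \<circ> (\<lambda>(s, \<tau>). (?x s, \<tau>)))"
      by (intro continuous_on_compose
          continuous_on_subset[OF smooth_field_continuous[OF smooth_field_partial_smooth[OF du]]])
        (auto simp: case_prod_unfold intro!: continuous_intros)
    then show "continuous_on (UNIV \<times> cbox 0 t) (\<lambda>(s, \<tau>). partial i (\<lambda>y. dt u y \<tau>) (?x s))"
      by (simp add: o_def case_prod_unfold)
  qed auto
  moreover have "integral (cbox 0 t) (dt u (?x s)) = u (?x s) t - u (?x s) 0" for s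
    using dt_has_integral[OF u t] by (simp add: integral_unique)
  ultimately have "((\<lambda>s. u (?x s) t - u (?x s) 0) has_vector_derivative
      integral {0..t} (\<lambda>\<tau>. partial i (\<lambda>y. dt u y \<tau>) x)) (at 0)"
    by simp
  moreover have "((\<lambda>s. u (?x s) t - u (?x s) 0) has_vector_derivative
      partial i (\<lambda>y. u y t) x - partial i (\<lambda>y. u y 0) x) (at 0)"
    by (intro has_vector_derivative_diff smooth_field_partial u t order.refl)
  ultimately show ?thesis
    by (rule vector_derivative_unique_at)
qed

lemma deriv_g: "deriv g c = c^3 - c"
  unfolding g_def[abs_def]
  by (rule DERIV_imp_deriv)
     (auto intro!: derivative_eq_intros simp: algebra_simps power2_eq_square power3_eq_cube)

text \<open>Separate fields \<open>s\<close> and \<open>r\<close> allow two uses: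
  \<open>r = s\<close> with \<open>c\<close> equal to \<epsilon> in the system, and coefficients of
  order 0 and 1 with \<open>c = 1\<close> in the limit. The factor \<open>3 * (s x t)^2 - 1\<close>
  is the second derivative of \<open>g\<close>.\<close>

lemma partial_potential:
  fixes s r p :: "real^'d::finite \<Rightarrow> real \<Rightarrow> real"
  assumes "smooth_field s" "smooth_field r" "smooth_field p" "t \<ge> 0"
  shows "partial i (\<lambda>y. deriv g (s y t) + (r y t - p y t) / c) x
    = (3 * (s x t)^2 - 1) * partial i (\<lambda>y. s y t) x
      + (partial i (\<lambda>y. r y t) x - partial i (\<lambda>y. p y t) x) / c"
proof (rule partialI)
  have d: "((\<lambda>h. u (x + h *\<^sub>R axis i 1) t) has_real_derivative partial i (\<lambda>y. u y t) x) (at 0)"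
    if "smooth_field u" for u :: "real^'d \<Rightarrow> real \<Rightarrow> real"
    using smooth_field_partial[OF that assms(4)]
    by (simp add: has_real_derivative_iff_has_vector_derivative)
  show "((\<lambda>h. deriv g (s (x + h *\<^sub>R axis i 1) t)
      + (r (x + h *\<^sub>R axis i 1) t - p (x + h *\<^sub>R axis i 1) t) / c) has_vector_derivative
      (3 * (s x t)^2 - 1) * partial i (\<lambda>y. s y t) x
      + (partial i (\<lambda>y. r y t) x - partial i (\<lambda>y. p y t) x) / c) (at 0)"
    unfolding deriv_g has_real_derivative_iff_has_vector_derivative[symmetric] divide_inverse
    by (rule derivative_eq_intros d[OF assms(1)] d[OF assms(2)] d[OF assms(3)] refl)+
       (simp add: algebra_simps)
qed

section \<open>Matching orders in the relaxation system\<close>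

theorem theorem1:
  fixes \<gamma> :: real and k2 k3 :: nat
    and L :: "real^'d::finite"
    and W :: "real \<Rightarrow> 'd state"
    and Wc :: "nat \<Rightarrow> 'd state"
    and c_init :: "real^'d \<Rightarrow> real"
  assumes "\<gamma> > 0" and "k2 > 0" and "k3 > 0"
    and "\<And>i. L $ i > 0"
    and "\<And>\<epsilon>. \<epsilon> > 0 \<Longrightarrow> smooth_periodic_state L (W \<epsilon>)"
    and "\<And>\<epsilon>. \<epsilon> > 0 \<Longrightarrow> relaxation_system \<gamma> \<epsilon> (\<gamma> * \<epsilon>^k2) (\<epsilon>^k3) (W \<epsilon>)"
    and "hilbert_expansion L W Wc"
    and "well_prepared c_init W"
  shows "cahn_hilliard \<gamma> (vs (Wc 0))"
proof -
  have sm: "smooth_field (vs (W \<epsilon>))" "smooth_field (qf (W \<epsilon>))" "smooth_field (wf (W \<epsilon>))"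
    "smooth_field (pf (W \<epsilon>))" "smooth_field (vp (W \<epsilon>))" if "\<epsilon> > 0" for \<epsilon>
    using assms(5)[OF that] unfolding smooth_periodic_state_def by auto
  have smc: "smooth_field (vs (Wc j))" "smooth_field (qf (Wc j))" "smooth_field (wf (Wc j))"
    "smooth_field (pf (Wc j))" "smooth_field (vp (Wc j))" for j
    using assms(7) unfolding hilbert_expansion_def smooth_periodic_state_def by auto
  have expand: "termwise_expansion (\<lambda>\<epsilon>. vs (W \<epsilon>)) (\<lambda>j. vs (Wc j))"
    "termwise_expansion (\<lambda>\<epsilon>. qf (W \<epsilon>)) (\<lambda>j. qf (Wc j))"
    "termwise_expansion (\<lambda>\<epsilon>. wf (W \<epsilon>)) (\<lambda>j. wf (Wc j))"
    "termwise_expansion (\<lambda>\<epsilon>. pf (W \<epsilon>)) (\<lambda>j. pf (Wc j))"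
    "termwise_expansion (\<lambda>\<epsilon>. vp (W \<epsilon>)) (\<lambda>j. vp (Wc j))"
    using assms(7) unfolding hilbert_expansion_def by auto
  \<comment> \<open>In \<open>ser\<close>, \<open>serdt\<close> and \<open>serpar\<close>, the facts
    (1) to (5) belong to \<open>vs\<close>, \<open>qf\<close>, \<open>wf\<close>, \<open>pf\<close>,
    \<open>vp\<close>.\<close>
  note ser = expand[unfolded termwise_expansion_def, rule_format, THEN conjunct1]
  note serdt = expand[unfolded termwise_expansion_def, rule_format,
      THEN conjunct2, THEN conjunct1]
  note serpar = expand[unfolded termwise_expansion_def, rule_format,
      THEN conjunct2, THEN conjunct2, rule_format]
  note limdt = serdt[THEN asymp_series_tendsto] and limpar = serpar[THEN asymp_series_tendsto]

  \<comment> \<open>Constants are pulled out of the divergences, so that the derivatives of the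
    fields themselves appear, which have expansions.\<close>
  have eqs: "dt (vs (W \<epsilon>)) x t + divergence (\<lambda>y. qf (W \<epsilon>) y t) x / \<epsilon>^k3 = 0"
    "dt (qf (W \<epsilon>)) x t + grad (\<lambda>y. deriv g (vs (W \<epsilon>) y t)
        + (vs (W \<epsilon>) y t - vp (W \<epsilon>) y t) / \<epsilon>) x = - (qf (W \<epsilon>) x t /\<^sub>R \<epsilon>^k3)"
    "dt (wf (W \<epsilon>)) x t - \<gamma> * divergence (\<lambda>y. pf (W \<epsilon>) y t) x
      = (vs (W \<epsilon>) x t - vp (W \<epsilon>) x t) / \<epsilon>"
    "dt (pf (W \<epsilon>)) x t - grad (\<lambda>y. wf (W \<epsilon>) y t) x /\<^sub>R (\<gamma> * \<epsilon>^k2) = 0"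
    "dt (vp (W \<epsilon>)) x t = wf (W \<epsilon>) x t / (\<gamma> * \<epsilon>^k2)" if "\<epsilon> > 0" "t \<ge> 0" for \<epsilon> x t
    using assms(6)[OF that(1)] that(2) sm[OF that(1)] unfolding relaxation_system_def
    by (simp_all add: divergence_scaleR divide_inverse_commute)

  have w: "wf (Wc k2) x t = \<gamma> * dt (vp (Wc 0)) x t" "j < k2 \<Longrightarrow> wf (Wc j) x t = 0"
    if "t \<ge> 0" for x t j
  proof -
    have eq: "wf (W \<epsilon>) x t = \<epsilon>^k2 *\<^sub>R (\<gamma> * dt (vp (W \<epsilon>)) x t)" if "\<epsilon> > 0" for \<epsilon>
      using eqs(5)[OF that \<open>t \<ge> 0\<close>] that assms(1) by simp
    have lim: "((\<lambda>\<epsilon>. \<gamma> * dt (vp (W \<epsilon>)) x t) \<longlongrightarrow> \<gamma> * dt (vp (Wc 0)) x t) (at_right 0)"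
      by (intro tendsto_intros limdt that)
    show "wf (Wc k2) x t = \<gamma> * dt (vp (Wc 0)) x t" "j < k2 \<Longrightarrow> wf (Wc j) x t = 0"
      using asymp_series_unique[OF ser(3)[OF that] eq lim] by auto
  qed

  \<comment> \<open>The coefficient of order \<open>k2\<close> in the space derivative of
    \<open>wf\<close> is compared, and \<open>w\<close> is then differentiated in space. This yields
    the space derivative of \<open>dt\<close>, in that order, which is the form that
    \<open>partial_dt_integral\<close> integrates.\<close>
  have pt: "dt (pf (Wc 0)) x t $ i = partial i (\<lambda>y. dt (vp (Wc 0)) y t) x" if "t \<ge> 0" for x t i
  proof -
    have eq: "partial i (\<lambda>y. wf (W \<epsilon>) y t) x = \<epsilon>^k2 *\<^sub>R (\<gamma> * dt (pf (W \<epsilon>)) x t $ i)"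
      if "\<epsilon> > 0" for \<epsilon>
      using arg_cong[OF eqs(4)[OF that \<open>t \<ge> 0\<close>, of x], of "\<lambda>v. v $ i"] that assms(1)
      by (simp add: grad_def field_simps)
    have lim: "((\<lambda>\<epsilon>. \<gamma> * dt (pf (W \<epsilon>)) x t $ i) \<longlongrightarrow> \<gamma> * dt (pf (Wc 0)) x t $ i) (at_right 0)"
      by (intro tendsto_intros limdt that)
    have "\<gamma> * dt (pf (Wc 0)) x t $ i = partial i (\<lambda>y. wf (Wc k2) y t) x"
      using asymp_series_unique(1)[OF serpar(3)[OF that] eq lim] by simp
    also have "\<dots> = \<gamma> * partial i (\<lambda>y. dt (vp (Wc 0)) y t) x"
      by (simp add: w[OF that] partial_cmult[OF smooth_field_dt_smooth[OF smc(5)] that])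
    finally show ?thesis
      using assms(1) by simp
  qed

  \<comment> \<open>The mismatch \<open>?D\<close> tends to 0 by well-preparedness and to the
    mismatch of the leading coefficients by the expansion.\<close>
  have p_init: "pf (Wc 0) x 0 $ i = partial i (\<lambda>y. vp (Wc 0) y 0) x" for x i
  proof -
    let ?D = "\<lambda>\<epsilon>. pf (W \<epsilon>) x 0 - grad (\<lambda>y. vp (W \<epsilon>) y 0) x"
    have "(\<lambda>\<epsilon>. norm (?D \<epsilon>)) \<in> O[at_right 0](\<lambda>\<epsilon>. \<epsilon>)"
      using assms(8) unfolding well_prepared_def by blast
    then obtain C where C: "eventually (\<lambda>\<epsilon>. norm (?D \<epsilon>) \<le> C * \<bar>\<epsilon>\<bar>) (at_right 0)"
      by (auto elim!: landau_o.bigE)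
    have "(?D \<longlongrightarrow> 0) (at_right 0)"
    proof (rule tendsto_0_le[OF tendsto_ident_at])
      show "eventually (\<lambda>\<epsilon>. norm (?D \<epsilon>) \<le> norm \<epsilon> * C) (at_right 0)"
        using C by (simp add: mult.commute)
    qed
    then have "((\<lambda>\<epsilon>. ?D \<epsilon> $ i) \<longlongrightarrow> 0 $ i) (at_right 0)"
      by (rule tendsto_vec_nth)
    moreover have "((\<lambda>\<epsilon>. ?D \<epsilon> $ i) \<longlongrightarrow>
        pf (Wc 0) x 0 $ i - partial i (\<lambda>y. vp (Wc 0) y 0) x) (at_right 0)"
      unfolding grad_def vector_minus_component vec_lambda_beta
      by (intro tendsto_intros limpar ser(4)[THEN asymp_series_tendsto] order.refl)
    ultimately show ?thesis
      using tendsto_unique[OF trivial_limit_at_right_real] by fastforce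
  qed

  \<comment> \<open>Integrating \<open>pt\<close> from 0 to \<open>t\<close> gives equal increments
    on both sides; \<open>p_init\<close> removes the initial values.\<close>
  have p0: "pf (Wc 0) x t $ i = partial i (\<lambda>y. vp (Wc 0) y t) x" if "t \<ge> 0" for x t i
  proof -
    have "((\<lambda>\<tau>. dt (pf (Wc 0)) x \<tau> $ i) has_integral (pf (Wc 0) x t - pf (Wc 0) x 0) $ i) {0..t}"
      using has_integral_linear[OF dt_has_integral[OF smc(4) that] bounded_linear_vec_nth]
      by (simp add: o_def)
    then have "pf (Wc 0) x t $ i - pf (Wc 0) x 0 $ i
        = integral {0..t} (\<lambda>\<tau>. dt (pf (Wc 0)) x \<tau> $ i)"
      by (simp add: integral_unique)
    also have "\<dots> = integral {0..t} (\<lambda>\<tau>. partial i (\<lambda>y. dt (vp (Wc 0)) y \<tau>) x)"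
      by (intro integral_cong) (simp add: pt)
    finally show ?thesis
      by (simp add: partial_dt_integral[OF smc(5) that] p_init)
  qed

  have s: "vs (Wc 0) x t = vp (Wc 0) x t"
    "vs (Wc 1) x t - vp (Wc 1) x t = - \<gamma> * divergence (\<lambda>y. pf (Wc 0) y t) x"
    if "t \<ge> 0" for x t
  proof -
    \<comment> \<open>The w-equation times \<epsilon>, matched with \<open>N = 1\<close>: order 0
      gives the first claim and order 1 the second, where \<open>dt (wf (Wc 0))\<close> drops out
      since \<open>k2 > 0\<close> forces \<open>wf (Wc 0)\<close> to vanish.\<close>
    have eq: "vs (W \<epsilon>) x t - vp (W \<epsilon>) x t = \<epsilon>^1 *\<^sub>R (dt (wf (W \<epsilon>)) x t
        - \<gamma> * (\<Sum>i\<in>UNIV. partial i (\<lambda>y. pf (W \<epsilon>) y t) x $ i))" if "\<epsilon> > 0" for \<epsilon>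
      using eqs(3)[OF that \<open>t \<ge> 0\<close>, of x] that sm(4)[OF that] \<open>t \<ge> 0\<close>
      by (simp add: divergence_def partial_nth)
    have lim: "((\<lambda>\<epsilon>. dt (wf (W \<epsilon>)) x t - \<gamma> * (\<Sum>i\<in>UNIV. partial i (\<lambda>y. pf (W \<epsilon>) y t) x $ i))
        \<longlongrightarrow> dt (wf (Wc 0)) x t - \<gamma> * (\<Sum>i\<in>UNIV. partial i (\<lambda>y. pf (Wc 0) y t) x $ i))
        (at_right 0)"
      by (intro tendsto_intros limdt limpar that)
    have "dt (wf (Wc 0)) x t = 0"
      using w(2)[OF _ assms(2)] that by (intro dt_zero)
    then show "vs (Wc 0) x t = vp (Wc 0) x t"
      "vs (Wc 1) x t - vp (Wc 1) x t = - \<gamma> * divergence (\<lambda>y. pf (Wc 0) y t) x"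
      using asymp_series_unique[OF asymp_series_diff[OF ser(1)[OF that] ser(5)[OF that]] eq lim]
      by (auto simp: divergence_def partial_nth smc that)
  qed

  \<comment> \<open>The division by \<open>1\<close> makes the left-hand side an instance of \<open>partial_potential\<close>.\<close>
  have mu: "deriv g (vs (Wc 0) y t) + (vs (Wc 1) y t - vp (Wc 1) y t) / 1
      = deriv g (vs (Wc 0) y t) - \<gamma> * laplacian (\<lambda>z. vs (Wc 0) z t) y" if "t \<ge> 0" for y t
  proof -
    have "pf (Wc 0) y t = grad (\<lambda>z. vs (Wc 0) z t) y" for y
      by (simp add: vec_eq_iff grad_def p0 s(1) that)
    then have "(\<lambda>y. pf (Wc 0) y t) = grad (\<lambda>z. vs (Wc 0) z t)"
      by blast
    then show ?thesis
      using s(2)[OF that, of y] by (simp add: laplacian_def)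
  qed

  \<comment> \<open>The limiting chemical potential. By \<open>mu\<close> it also has a form in the
    coefficients of order 0 and 1, which is the one that the q-equation produces.\<close>
  define F where "F t = (\<lambda>y. deriv g (vs (Wc 0) y t) - \<gamma> * laplacian (\<lambda>z. vs (Wc 0) z t) y)" for t
  have q: "qf (Wc k3) x t $ i = - (dt (qf (Wc 0)) x t $ i + partial i (F t) x)"
    "j < k3 \<Longrightarrow> qf (Wc j) x t $ i = 0" if "t \<ge> 0" for x t i j
  proof -
    let ?h = "\<lambda>\<epsilon>. - (dt (qf (W \<epsilon>)) x t $ i + ((3 * (vs (W \<epsilon>) x t)^2 - 1) * partial i (\<lambda>y. vs (W \<epsilon>) y t) x
      + (partial i (\<lambda>y. vs (W \<epsilon>) y t) x - partial i (\<lambda>y. vp (W \<epsilon>) y t) x) /\<^sub>R \<epsilon>^1))"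
    have eq: "qf (W \<epsilon>) x t $ i = \<epsilon>^k3 *\<^sub>R ?h \<epsilon>" if "\<epsilon> > 0" for \<epsilon>
    proof -
      have "?h \<epsilon> = inverse (\<epsilon>^k3) * qf (W \<epsilon>) x t $ i"
        using arg_cong[OF eqs(2)[OF that \<open>t \<ge> 0\<close>, of x], of "\<lambda>v. v $ i"]
        by (simp add: grad_def divide_inverse_commute
            partial_potential[OF sm(1)[OF that] sm(1)[OF that] sm(5)[OF that] \<open>t \<ge> 0\<close>,
              unfolded divide_inverse_commute])
      then show ?thesis
        using that by simp
    qed
    \<comment> \<open>The singular term stays bounded: equality of the order-0 coefficients at every
      point makes their space derivatives cancel, so division by \<epsilon> leaves the order-1
      difference.\<close>
    have "(\<lambda>y. vs (Wc 0) y t) = (\<lambda>y. vp (Wc 0) y t)"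
      using s(1)[OF that] by blast
    then have "((\<lambda>\<epsilon>. (partial i (\<lambda>y. vs (W \<epsilon>) y t) x - partial i (\<lambda>y. vp (W \<epsilon>) y t) x) /\<^sub>R \<epsilon>^1)
        \<longlongrightarrow> partial i (\<lambda>y. vs (Wc 1) y t) x - partial i (\<lambda>y. vp (Wc 1) y t) x) (at_right 0)"
      by (intro asymp_series_leading[OF asymp_series_diff[OF serpar(1)[OF that] serpar(5)[OF that]]])
         simp
    then have lim: "(?h \<longlongrightarrow> - (dt (qf (Wc 0)) x t $ i
        + ((3 * (vs (Wc 0) x t)^2 - 1) * partial i (\<lambda>y. vs (Wc 0) y t) x
        + (partial i (\<lambda>y. vs (Wc 1) y t) x - partial i (\<lambda>y. vp (Wc 1) y t) x)))) (at_right 0)"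
      by (intro tendsto_intros limdt limpar ser(1)[THEN asymp_series_tendsto] that)
    have F: "partial i (F t) x = (3 * (vs (Wc 0) x t)^2 - 1) * partial i (\<lambda>y. vs (Wc 0) y t) x
        + (partial i (\<lambda>y. vs (Wc 1) y t) x - partial i (\<lambda>y. vp (Wc 1) y t) x)"
      unfolding F_def mu[OF that, symmetric]
      by (simp add: partial_potential[OF smc(1) smc(1) smc(5) that] del: div_by_1) simp
    show "qf (Wc k3) x t $ i = - (dt (qf (Wc 0)) x t $ i + partial i (F t) x)"
      "j < k3 \<Longrightarrow> qf (Wc j) x t $ i = 0"
      unfolding F using asymp_series_unique[OF asymp_series_nth[OF ser(2)[OF that]] eq lim] by auto
  qed
  have q_low: "qf (Wc j) x t = 0" if "t \<ge> 0" "j < k3" for j x t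
    using q(2)[OF that] by (simp add: vec_eq_iff)
  have q_k3: "grad (F t) x = - qf (Wc k3) x t" if "t \<ge> 0" for x t
  proof -
    \<comment> \<open>Since \<open>k3 > 0\<close>, the coefficient \<open>qf (Wc 0)\<close> is among
      the vanishing ones, so no inertial term survives.\<close>
    have "dt (qf (Wc 0)) x t = 0"
      using q_low assms(3) that by (intro dt_zero) auto
    then show ?thesis
      using q(1)[OF that] by (simp add: vec_eq_iff grad_def)
  qed

  have "dt (vs (Wc 0)) x t = laplacian (F t) x" if "t \<ge> 0" for x t
  proof -
    \<comment> \<open>The coefficients of \<open>qf\<close> below order \<open>k3\<close> vanish
      identically in space, hence so do their space derivatives, and the rescaled divergence
      converges. By the first equation it equals \<open>- dt (vs (W \<epsilon>)) x t\<close>, whose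
      limit is known too.\<close>
    have "((\<lambda>\<epsilon>. \<Sum>i\<in>UNIV. (partial i (\<lambda>y. qf (W \<epsilon>) y t) x /\<^sub>R \<epsilon>^k3) $ i)
        \<longlongrightarrow> (\<Sum>i\<in>UNIV. partial i (\<lambda>y. qf (Wc k3) y t) x $ i)) (at_right 0)"
      by (intro tendsto_intros asymp_series_leading[OF serpar(2)[OF that]] partial_zero q_low that)
    moreover have "eventually (\<lambda>\<epsilon>. (\<Sum>i\<in>UNIV. (partial i (\<lambda>y. qf (W \<epsilon>) y t) x /\<^sub>R \<epsilon>^k3) $ i)
        = - dt (vs (W \<epsilon>)) x t) (at_right 0)"
      using eventually_at_right_less[of "0::real"]
    proof eventually_elim
      case (elim \<epsilon>)
      then show ?case
        using eqs(1)[OF elim that, of x] sm(2)[OF elim] that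
        by (simp add: divergence_def partial_nth divide_inverse_commute sum_distrib_left)
    qed
    ultimately have "((\<lambda>\<epsilon>. - dt (vs (W \<epsilon>)) x t)
        \<longlongrightarrow> divergence (\<lambda>y. qf (Wc k3) y t) x) (at_right 0)"
      using smc(2) that by (simp add: divergence_def partial_nth Lim_transform_eventually)
    moreover have "((\<lambda>\<epsilon>. - dt (vs (W \<epsilon>)) x t) \<longlongrightarrow> - dt (vs (Wc 0)) x t) (at_right 0)"
      by (intro tendsto_intros limdt that)
    ultimately have "divergence (\<lambda>y. qf (Wc k3) y t) x = - dt (vs (Wc 0)) x t"
      by (rule tendsto_unique[OF trivial_limit_at_right_real])
    \<comment> \<open>The sign is written as a scalar factor so that
      \<open>divergence_scaleR\<close> can extract it.\<close>
    moreover have "grad (F t) = (\<lambda>y. (- 1) *\<^sub>R qf (Wc k3) y t)"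
      using q_k3[OF that] by auto
    ultimately show ?thesis
      using divergence_scaleR[OF smc(2) that, of "- 1" k3 x] by (simp add: laplacian_def)
  qed
  then show ?thesis
    unfolding cahn_hilliard_def F_def by blast
qed

end
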